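(* Let $k$ be a field of characteristic different from $2$. For a function $f:(\mathbb{Z}_2)^n\times(\mathbb{Z}_2)^n\to\mathbb{Z}_2$ put $F=(-1)^f$. Then: (i) The complex number algebra over $k$ is of the form $k_FG$ with $G=\mathbb{Z}_2$ and $f(x,y)=xy$. (ii) The quaternion algebra over $k$ is of the form $k_FG$ with $G=\mathbb{Z}_2\times\mathbb{Z}_2$ and $f(\vec x,\vec y)=x_1y_1+(x_1+x_2)y_2$. (iii) The octonion algebra over $k$ is of the form $k_FG$ with $G=\mathbb{Z}_2\times\mathbb{Z}_2\times\mathbb{Z}_2$ and $$f(\vec x,\vec y)=\sum_{1\le i\le j\le 3}x_iy_j+y_1x_2x_3+x_1y_2x_3+x_1x_2y_3.$$ (iv) The 16-onion algebra over $k$ is of the form $k_FG$ with $G=(\mathbb{Z}_2)^4$ and $$f(\vec x,\vec y)=\sum_{1\le i\le j\le 4}x_iy_j+\sum_{\substack{1\le i<j\le 4\\ k\ne i,j}}x_ix_jy_k+\sum_{l=1}^4\Big(\prod_{i\neq l}x_i\Big)y_l+\sum_{\substack{\{i,j,k\}=\{1,2,3\}\\ j<k}}x_iy_jy_kx_4,$$ where in the second sum $k$ ranges over $\{1,2,3,4\}\setminus\{i,j\}$.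
   Context: Here $\mathbb{Z}_2=\{0,1\}$ is written additively, its ring product is also used, and $\vec x=(x_1,\dots,x_n)\in(\mathbb{Z}_2)^n$. For an abelian group $G$ with identity $e$ and a map $F:G\times G\to k^*$ with $F(x,e)=F(e,x)=1$, $k_FG$ denotes the $k$-vector space with basis $G$ and bilinear product $x\cdot y=F(x,y)\,xy$ ($xy$ being the product in $G$). Given a finite-dimensional unital algebra $A$ with involution $\sigma$ such that $a+\sigma(a),\,a\cdot\sigma(a)\in k1$ for all $a\in A$, the Cayley–Dickson process with parameter $\alpha$ yields the algebra $\bar A=A\oplus vA$ with product $(a+vb)\cdot(c+vd)=(a\cdot c+\alpha\, d\cdot\sigma(b))+v(\sigma(a)\cdot d+c\cdot b)$ and involution $\bar\sigma(a+vb)=\sigma(a)-vb$. Starting from $A=k$ with $\sigma=\mathrm{id}$ and iterating with $\alpha=-1$ one obtains successively the complex number algebra $k[v]/(v^2+1)$, the quaternion algebra, the octonion algebra and the 16-onion algebra over $k$ (of dimensions $2,4,8,16$). "Of the form $k_FG$" means isomorphic as an algebra to $k_FG$. *)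

theory Defs
  imports "HOL-Analysis.Analysis" "HOL-Library.Poly_Mapping" "HOL-Library.Z2"
begin

text \<open>
  A (not necessarily associative) algebra over the field \<open>'k\<close> has the full type \<open>'a\<close> as its
  underlying set; its addition is that of the class \<open>ab_group_add\<close>.
\<close>

record ('k, 'a) nonassoc_algebra =
  scal :: "'k \<Rightarrow> 'a \<Rightarrow> 'a"
  mul :: "'a \<Rightarrow> 'a \<Rightarrow> 'a"
  unit :: 'a

record ('k, 'a) inv_algebra = "('k, 'a) nonassoc_algebra" +
  invol :: "'a \<Rightarrow> 'a"

definition unital_algebra ::
  "('k::field, 'a::ab_group_add, 'z) nonassoc_algebra_scheme \<Rightarrow> bool" where
  "unital_algebra A \<longleftrightarrow>
     vector_space (scal A) \<and>
     (\<forall>a. Vector_Spaces.linear (scal A) (scal A) (\<lambda>b. mul A a b)) \<and>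
     (\<forall>b. Vector_Spaces.linear (scal A) (scal A) (\<lambda>a. mul A a b)) \<and>
     (\<forall>a. mul A (unit A) a = a \<and> mul A a (unit A) = a)"

definition algebra_isomorphic ::
  "('k::field, 'a::ab_group_add, 'z) nonassoc_algebra_scheme \<Rightarrow>
   ('k, 'b::ab_group_add, 'y) nonassoc_algebra_scheme \<Rightarrow> bool" where
  "algebra_isomorphic A B \<longleftrightarrow>
     (\<exists>\<phi>. Vector_Spaces.linear (scal A) (scal B) \<phi> \<and> bij \<phi> \<and> \<phi> (unit A) = unit B \<and>
          (\<forall>a b. \<phi> (mul A a b) = mul B (\<phi> a) (\<phi> b)))"


section \<open>The Cayley--Dickson process\<close>

text \<open>The algebras the process may be applied to.\<close>

definition cayley_dickson_admissible ::
  "('k::field, 'a::ab_group_add) inv_algebra \<Rightarrow> bool" where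
  "cayley_dickson_admissible A \<longleftrightarrow>
     unital_algebra A \<and>
     (\<exists>B. finite B \<and> module.span (scal A) B = UNIV) \<and>
     Vector_Spaces.linear (scal A) (scal A) (invol A) \<and>
     (\<forall>a. invol A (invol A a) = a) \<and>
     (\<forall>a b. invol A (mul A a b) = mul A (invol A b) (invol A a)) \<and>
     (\<forall>a. \<exists>c. a + invol A a = scal A c (unit A)) \<and>
     (\<forall>a. \<exists>c. mul A a (invol A a) = scal A c (unit A))"

text \<open>The pair \<open>(a, b)\<close> stands for \<open>a + v b\<close>.\<close>

definition cayley_dickson ::
  "'k::field \<Rightarrow> ('k, 'a::ab_group_add) inv_algebra \<Rightarrow> ('k, 'a \<times> 'a) inv_algebra" where
  "cayley_dickson \<alpha> A =
     \<lparr> scal = (\<lambda>t (a, b). (scal A t a, scal A t b)),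
       mul = (\<lambda>(a, b) (c, d).
         (mul A a c + scal A \<alpha> (mul A d (invol A b)), mul A (invol A a) d + mul A c b)),
       unit = (unit A, 0),
       invol = (\<lambda>(a, b). (invol A a, - b)) \<rparr>"

definition ground_algebra :: "('k::field, 'k) inv_algebra" where
  "ground_algebra = \<lparr> scal = (*), mul = (*), unit = 1, invol = id \<rparr>"

definition complex_number_algebra :: "('k::field, 'k \<times> 'k) inv_algebra" where
  "complex_number_algebra = cayley_dickson (- 1) ground_algebra"

definition quaternion_algebra :: "('k::field, ('k \<times> 'k) \<times> ('k \<times> 'k)) inv_algebra" where
  "quaternion_algebra = cayley_dickson (- 1) complex_number_algebra"

definition octonion_algebra ::
  "('k::field, (('k \<times> 'k) \<times> ('k \<times> 'k)) \<times> (('k \<times> 'k) \<times> ('k \<times> 'k))) inv_algebra" where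
  "octonion_algebra = cayley_dickson (- 1) quaternion_algebra"

definition sixteen_onion_algebra ::
  "('k::field, ((('k \<times> 'k) \<times> ('k \<times> 'k)) \<times> (('k \<times> 'k) \<times> ('k \<times> 'k))) \<times>
               ((('k \<times> 'k) \<times> ('k \<times> 'k)) \<times> (('k \<times> 'k) \<times> ('k \<times> 'k)))) inv_algebra" where
  "sixteen_onion_algebra = cayley_dickson (- 1) octonion_algebra"

lemma ground_algebra_admissible:
  "cayley_dickson_admissible (ground_algebra :: ('k::field, 'k) inv_algebra)"
proof -
  note vs = vector_space_over_itself.vector_space_axioms
  have lin: "Vector_Spaces.linear (*) (*) f"
    if "\<And>x y. f (x + y) = f x + f y" "\<And>t x. f (t * x) = t * f x" for f :: "'k \<Rightarrow> 'k"
    using that by (intro Vector_Spaces.linear.intro module_hom.intro module_hom_axioms.intro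
        vs vector_space_over_itself.module_axioms)
  have "x \<in> module.span (*) {1}" for x :: 'k
    using vector_space_over_itself.span_scale[OF vector_space_over_itself.span_base[of 1 "{1}"], of x]
    by simp
  then have "\<exists>B. finite B \<and> module.span (*) B = (UNIV :: 'k set)"
    by (intro exI[of _ "{1}"]) auto
  then show ?thesis
    unfolding cayley_dickson_admissible_def unital_algebra_def ground_algebra_def
    by (auto intro!: lin vs simp: algebra_simps)
qed

lemma cayley_dickson_admissible_cayley_dickson:
  fixes A :: "('k::field, 'a::ab_group_add) inv_algebra"
  assumes "cayley_dickson_admissible A"
  shows "cayley_dickson_admissible (cayley_dickson \<alpha> A)"
proof -
  let ?s = "scal A" and ?m = "mul A" and ?i = "invol A" and ?e = "unit A"
  let ?S = "\<lambda>t (a, b). (?s t a, ?s t b)"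
  note defs = assms[unfolded cayley_dickson_admissible_def unital_algebra_def]
  obtain B where fin: "finite B" and spanB: "module.span ?s B = UNIV"
    using defs by (elim conjE exE)
  have vs: "vector_space ?s"
    using defs by (elim conjE)
  have linl: "Vector_Spaces.linear ?s ?s (\<lambda>b. ?m a b)"
    and linr: "Vector_Spaces.linear ?s ?s (\<lambda>b. ?m b a)"
    and lini: "Vector_Spaces.linear ?s ?s ?i"
    and ul: "?m ?e a = a" and ur: "?m a ?e = a"
    and ii: "?i (?i a) = a" and im: "?i (?m a b) = ?m (?i b) (?i a)"
    and tr: "\<exists>c. a + ?i a = ?s c ?e" and nm: "\<exists>c. ?m a (?i a) = ?s c ?e" for a b
    using defs by simp_all
  interpret V: vector_space ?s by (rule vs)
  interpret L: Vector_Spaces.linear ?s ?s "\<lambda>b. ?m a b" for a by (rule linl)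
  interpret R: Vector_Spaces.linear ?s ?s "\<lambda>a. ?m a b" for b by (rule linr)
  interpret I: Vector_Spaces.linear ?s ?s ?i by (rule lini)
  have ie: "?i ?e = ?e" using im[of "?i ?e" ?e] ii ul ur by metis
  note alg = L.add R.add I.add L.scale R.scale I.scale L.zero R.zero I.zero L.neg R.neg I.neg
    V.scale_right_distrib V.scale_left_distrib ul ur ii im ie
  interpret P: vector_space ?S
    by unfold_locales (auto simp: V.scale_right_distrib V.scale_left_distrib)
  have linI: "Vector_Spaces.linear ?S ?S f"
    if "\<And>x y. f (x + y) = f x + f y" "\<And>t x. f (?S t x) = ?S t (f x)" for f
    using that by (intro Vector_Spaces.linear.intro module_hom.intro module_hom_axioms.intro
        P.vector_space_axioms P.module_axioms)
  let ?B = "(\<lambda>b. (b, 0)) ` B \<union> (\<lambda>b. (0, b)) ` B"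
  have "x \<in> P.span ?B" for x
  proof -
    have 1: "(a, 0) \<in> P.span ?B" if "a \<in> V.span B" for a
      using that
    proof (induction rule: V.span_induct_alt)
      case base
      show ?case using P.span_zero[of ?B] by (simp add: zero_prod_def)
    next
      case (step c x y)
      from P.span_add[OF P.span_scale[OF P.span_base[of "(x, 0)" ?B], of c] step(2)] step(1)
      show ?case by simp
    qed
    have 2: "(0, a) \<in> P.span ?B" if "a \<in> V.span B" for a
      using that
    proof (induction rule: V.span_induct_alt)
      case base
      show ?case using P.span_zero[of ?B] by (simp add: zero_prod_def)
    next
      case (step c x y)
      from P.span_add[OF P.span_scale[OF P.span_base[of "(0, x)" ?B], of c] step(2)] step(1)
      show ?case by simp
    qed
    show ?thesis using P.span_add[OF 1 2, of "fst x" "snd x"] spanB by simp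
  qed
  then have fd: "\<exists>C. finite C \<and> P.span C = UNIV"
    using fin by (intro exI[of _ ?B]) auto
  have tr': "\<exists>c. (a, b) + (?i a, - b) = (?s c ?e, ?s c 0)" for a b
    using tr[of a] by auto
  have nm': "\<exists>c. ?m a (?i a) + ?s \<alpha> (?m (- b) (?i b)) = ?s c ?e
      \<and> ?m (?i a) (- b) + ?m (?i a) b = ?s c 0" for a b
  proof -
    obtain c d where "?m a (?i a) = ?s c ?e" "?m b (?i b) = ?s d ?e"
      using nm by meson
    then have "?m a (?i a) + ?s \<alpha> (?m (- b) (?i b)) = ?s (c - \<alpha> * d) ?e"
      by (simp add: alg V.scale_left_diff_distrib)
    then show ?thesis by (auto simp: alg)
  qed
  have linP: "Vector_Spaces.linear ?S ?S (\<lambda>x. mul (cayley_dickson \<alpha> A) a x)" (is ?G1)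
    and linQ: "Vector_Spaces.linear ?S ?S (\<lambda>x. mul (cayley_dickson \<alpha> A) x a)" (is ?G2)
    and linJ: "Vector_Spaces.linear ?S ?S (invol (cayley_dickson \<alpha> A))" (is ?G3) for a
  proof -
    show ?G1 by (rule linI; cases a)
        (auto simp: cayley_dickson_def alg ac_simps mult.commute)
    show ?G2 by (rule linI; cases a)
        (auto simp: cayley_dickson_def alg ac_simps mult.commute)
    show ?G3 by (rule linI) (auto simp: cayley_dickson_def alg)
  qed
  let ?C = "cayley_dickson \<alpha> A"
  have sc: "scal ?C = ?S" by (simp add: cayley_dickson_def)
  have ua: "unital_algebra ?C"
    unfolding unital_algebra_def sc using linP linQ P.vector_space_axioms
    by (auto simp: cayley_dickson_def alg)
  have am: "invol ?C (mul ?C x y) = mul ?C (invol ?C y) (invol ?C x)" for x y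
    by (cases x; cases y) (simp add: cayley_dickson_def alg)
  have t: "\<exists>c. x + invol ?C x = scal ?C c (unit ?C)" for x
    using tr' by (cases x) (simp add: cayley_dickson_def)
  have n: "\<exists>c. mul ?C x (invol ?C x) = scal ?C c (unit ?C)" for x
    using nm' by (cases x) (simp add: cayley_dickson_def)
  have i: "invol ?C (invol ?C x) = x" for x
    by (cases x) (simp add: cayley_dickson_def ii)
  show ?thesis
    unfolding cayley_dickson_admissible_def
    using ua fd linJ i am t n unfolding sc by blast
qed


section \<open>The algebras $k_F G$\<close>

text \<open>
  The group \<open>G\<close> is the full type \<open>'g\<close>, written additively, so that its identity \<open>e\<close> is \<open>0\<close>.
  The free vector space with basis \<open>G\<close> is the space \<open>'g \<Rightarrow>\<^sub>0 'k\<close> of finitely supported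
  functions; \<open>Poly_Mapping.single x 1\<close> is the basis vector \<open>x\<close>.
\<close>

definition unital_cochain :: "('g::ab_group_add \<Rightarrow> 'g \<Rightarrow> 'k::field) \<Rightarrow> bool" where
  "unital_cochain F \<longleftrightarrow> (\<forall>x y. F x y \<noteq> 0) \<and> (\<forall>x. F x 0 = 1 \<and> F 0 x = 1)"

definition twisted_group_algebra ::
  "('g::ab_group_add \<Rightarrow> 'g \<Rightarrow> 'k::field) \<Rightarrow> ('k, 'g \<Rightarrow>\<^sub>0 'k) nonassoc_algebra" where
  "twisted_group_algebra F =
     \<lparr> scal = (\<lambda>t. Poly_Mapping.map ((*) t)),
       mul = (\<lambda>p q. \<Sum>x\<in>Poly_Mapping.keys p. \<Sum>y\<in>Poly_Mapping.keys q.
         Poly_Mapping.single (x + y)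
           (Poly_Mapping.lookup p x * Poly_Mapping.lookup q y * F x y)),
       unit = Poly_Mapping.single 0 1 \<rparr>"

definition of_form_kFG ::
  "('k::field, 'a::ab_group_add, 'z) nonassoc_algebra_scheme \<Rightarrow>
   ('g::ab_group_add \<Rightarrow> 'g \<Rightarrow> 'k) \<Rightarrow> bool" where
  "of_form_kFG A F \<longleftrightarrow> unital_cochain F \<and> algebra_isomorphic A (twisted_group_algebra F)"

text \<open>The map $(-1)^f$.\<close>

definition sign_cochain :: "('g \<Rightarrow> 'g \<Rightarrow> bit) \<Rightarrow> 'g \<Rightarrow> 'g \<Rightarrow> 'k::field" where
  "sign_cochain f x y = (if f x y = 0 then 1 else - 1)"

text \<open>
  The \<open>i\<close>-th coordinate $x_i$ of a vector $x \in (\mathbb{Z}_2)^n$, for \<open>1 \<le> i \<le> n\<close>. In the numeral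
  type \<open>n\<close> the number \<open>n\<close> equals \<open>0\<close>, hence the natural numbers \<open>1, \<dots>, n\<close> are in
  bijection with the index type, but its own order is not the order of \<open>1, \<dots>, n\<close>.
\<close>

definition coord :: "bit ^ 'n::{finite, comm_ring_1} \<Rightarrow> nat \<Rightarrow> bit" where
  "coord x i = x $ of_nat i"

end

theory Submission
  imports Defs
begin

text \<open>
  Each algebra in the list has a basis \<open>e\<close> indexed by a group \<open>G = (\<int>/2)\<^sup>n\<close> with
  \<open>e x \<cdot> e y = F x y e (x + y)\<close>, with \<open>e 0\<close> as unit, and with an involution that fixes \<open>e 0\<close> and
  negates every other basis vector. Extending \<open>x \<mapsto> e x\<close> linearly gives an algebra isomorphism
  from \<open>k\<^sub>F G\<close> (\<open>of_form_kFG\<close> in the locale \<open>twisted_basis\<close>).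

  The point is that one step of the Cayley--Dickson process preserves this situation. The algebra
  \<open>A \<oplus> v A\<close> has the basis vectors \<open>e g\<close> and \<open>v e g\<close>, indexed by \<open>G \<times> \<int>/2\<close>. Because the involution
  acts on each basis vector by a sign and \<open>G\<close> is commutative, all four kinds of products of these
  vectors are scalar multiples of basis vectors:
  \<open>e g \<cdot> e h = F g h e (g + h)\<close>, \<open>e g \<cdot> v e h = s g F g h v e (g + h)\<close>,
  \<open>v e g \<cdot> e h = F h g v e (g + h)\<close> and \<open>v e g \<cdot> v e h = \<alpha> s g F h g e (g + h)\<close>, where \<open>s g\<close> is
  the sign of \<open>e g\<close> under the involution. The involution on \<open>A \<oplus> v A\<close> again fixes the unit and
  negates every other basis vector (\<open>twisted_basis_cayley_dickson\<close>).

  For \<open>\<alpha> = -1\<close> and \<open>F = (-1)\<^sup>f\<close> these four scalars are \<open>(-1)\<close> to the power of one polynomial in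
  \<open>f\<close> and the new coordinates (\<open>doubled_exponent\<close>). Starting from \<open>f = 0\<close> on the trivial group, four
  doublings give the four exponents, and each comparison with the closed formula is a polynomial
  identity over the field with two elements.
\<close>

section \<open>Algebras with a twisted group basis\<close>

instance bit :: finite
proof
  have "(UNIV :: bit set) \<subseteq> {0, 1}"
    by (metis (full_types) bit_not_one_iff insertCI subsetI)
  then show "finite (UNIV :: bit set)"
    by (rule finite_subset) simp
qed

lemma UNIV_bit: "(UNIV :: bit set) = {0, 1}"
  by (metis (full_types) UNIV_eq_I bit_not_one_iff insertCI)

lemma linear_iff_vector_space:
  assumes "vector_space s" "vector_space s'"
  shows "Vector_Spaces.linear s s' h \<longleftrightarrow>
    (\<forall>x y. h (x + y) = h x + h y) \<and> (\<forall>t x. h (s t x) = s' t (h x))"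
  using assms module_hom_iff[of s s' h]
  by (auto simp: Vector_Spaces.linear_def module_iff_vector_space)

lemma lookup_scal_twisted_group_algebra:
  "Poly_Mapping.lookup (scal (twisted_group_algebra F) t p) x = t * Poly_Mapping.lookup p x"
  by (simp add: twisted_group_algebra_def Poly_Mapping.map.rep_eq when_def)

locale twisted_basis =
  fixes A :: "('k::field, 'a::ab_group_add) inv_algebra"
    and F :: "'g::{finite, ab_group_add} \<Rightarrow> 'g \<Rightarrow> 'k"
    and e :: "'g \<Rightarrow> 'a"
  assumes admissible: "cayley_dickson_admissible A"
    and cochain: "unital_cochain F"
    and independent: "(\<Sum>x\<in>UNIV. scal A (c x) (e x)) = 0 \<Longrightarrow> c x = 0"
    and spanning: "\<exists>c. a = (\<Sum>x\<in>UNIV. scal A (c x) (e x))"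
    and mul_basis: "mul A (e x) (e y) = scal A (F x y) (e (x + y))"
    and invol_basis: "invol A (e x) = (if x = 0 then e x else - e x)"
    and unit_basis: "unit A = e 0"
begin

lemma vector_space: "vector_space (scal A)"
  and mul_linear_right: "Vector_Spaces.linear (scal A) (scal A) (\<lambda>b. mul A a b)"
  and mul_linear_left: "Vector_Spaces.linear (scal A) (scal A) (\<lambda>a. mul A a b)"
  using admissible unfolding cayley_dickson_admissible_def unital_algebra_def by auto

sublocale V: vector_space "scal A" by (rule vector_space)
sublocale R: Vector_Spaces.linear "scal A" "scal A" "\<lambda>b. mul A a b" for a
  by (rule mul_linear_right)
sublocale L: Vector_Spaces.linear "scal A" "scal A" "\<lambda>a. mul A a b" for b
  by (rule mul_linear_left)

text \<open>
  The isomorphism is built in this direction, from \<open>k\<^sub>F G\<close> to the algebra, because here it has an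
  explicit formula; the inverse, which reads off coordinates, has none.
\<close>

definition combination :: "('g \<Rightarrow>\<^sub>0 'k) \<Rightarrow> 'a" where
  "combination p = (\<Sum>x\<in>UNIV. scal A (Poly_Mapping.lookup p x) (e x))"

lemma combination_add: "combination (p + q) = combination p + combination q"
  by (simp add: combination_def lookup_add V.scale_left_distrib sum.distrib)

lemma combination_zero: "combination 0 = 0"
  by (simp add: combination_def)

lemma combination_scal:
  "combination (scal (twisted_group_algebra F) t p) = scal A t (combination p)"
  by (simp add: combination_def lookup_scal_twisted_group_algebra V.scale_sum_right)

lemma combination_single: "combination (Poly_Mapping.single x c) = scal A c (e x)"
proof -
  have "combination (Poly_Mapping.single x c) = (\<Sum>y\<in>UNIV. if x = y then scal A c (e y) else 0)"
    unfolding combination_def by (rule sum.cong) (auto simp: lookup_single)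
  then show ?thesis by simp
qed

lemma combination_sum: "combination (\<Sum>i\<in>I. p i) = (\<Sum>i\<in>I. combination (p i))"
  by (induction I rule: infinite_finite_induct) (auto simp: combination_add combination_zero)

lemma combination_unit: "combination (unit (twisted_group_algebra F)) = unit A"
  by (simp add: twisted_group_algebra_def combination_single unit_basis del: single_one)

lemma combination_mul:
  "combination (mul (twisted_group_algebra F) p q) = mul A (combination p) (combination q)"
proof -
  let ?c = "\<lambda>x y. Poly_Mapping.lookup p x * Poly_Mapping.lookup q y * F x y"
  let ?term = "\<lambda>x y. Poly_Mapping.single (x + y) (?c x y)"
  have "mul (twisted_group_algebra F) p q = (\<Sum>x\<in>Poly_Mapping.keys p. \<Sum>y\<in>UNIV. ?term x y)"
    unfolding twisted_group_algebra_def nonassoc_algebra.simps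
    by (intro sum.cong refl sum.mono_neutral_left) (auto simp: in_keys_iff)
  also have "\<dots> = (\<Sum>x\<in>UNIV. \<Sum>y\<in>UNIV. ?term x y)"
    by (rule sum.mono_neutral_left) (auto simp: in_keys_iff)
  finally have "combination (mul (twisted_group_algebra F) p q) =
      (\<Sum>x\<in>UNIV. \<Sum>y\<in>UNIV. scal A (?c x y) (e (x + y)))"
    by (simp add: combination_sum combination_single)
  also have "\<dots> = mul A (combination p) (combination q)"
    unfolding combination_def L.sum R.sum L.scale R.scale mul_basis
    by (subst sum.swap) (simp add: V.scale_sum_right mult_ac)
  finally show ?thesis .
qed

lemma combination_bij: "bij combination"
proof (rule bijI)
  show "inj combination"
  proof (rule injI)
    fix p q assume "combination p = combination q"
    then have "(\<Sum>x\<in>UNIV. scal A (Poly_Mapping.lookup p x - Poly_Mapping.lookup q x) (e x)) = 0"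
      by (simp add: combination_def V.scale_left_diff_distrib sum_subtractf)
    from independent[OF this] have "Poly_Mapping.lookup p x = Poly_Mapping.lookup q x" for x
      by simp
    then show "p = q" by (rule poly_mapping_eqI)
  qed
  show "surj combination"
  proof (rule surjI)
    fix a
    let ?c = "SOME c. a = (\<Sum>x\<in>UNIV. scal A (c x) (e x))"
    show "combination (\<Sum>x\<in>UNIV. Poly_Mapping.single x (?c x)) = a"
      using someI_ex[OF spanning[of a]] by (simp add: combination_sum combination_single)
  qed
qed

theorem of_form_kFG: "of_form_kFG A F"
proof -
  let ?B = "twisted_group_algebra F"
  have surj: "combination (inv combination a) = a" for a
    using combination_bij by (simp add: bij_is_surj surj_f_inv_f)
  have inj: "inv combination (combination p) = p" for p
    using combination_bij by (simp add: bij_is_inj)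
  have vsB: "vector_space (scal ?B)"
    by unfold_locales (auto intro!: poly_mapping_eqI
        simp: lookup_scal_twisted_group_algebra lookup_add algebra_simps)
  have "Vector_Spaces.linear (scal A) (scal ?B) (inv combination)"
    unfolding linear_iff_vector_space[OF vector_space vsB]
    by (metis combination_add combination_scal inj surj)
  moreover have "bij (inv combination)"
    using combination_bij by (rule bij_imp_bij_inv)
  moreover have "inv combination (unit A) = unit ?B"
    by (metis combination_unit inj)
  moreover have "inv combination (mul A a b) = mul ?B (inv combination a) (inv combination b)" for a b
    by (metis combination_mul inj surj)
  ultimately show ?thesis
    using cochain unfolding of_form_kFG_def algebra_isomorphic_def by blast
qed

end

section \<open>The Cayley--Dickson process on such a basis\<close>

lemma twisted_basis_ground:
  "twisted_basis (ground_algebra :: ('k::field, 'k) inv_algebra) (\<lambda>x y :: num1. 1) (\<lambda>x. 1)"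
proof
  have num1: "x = y" for x y :: num1
    by (metis num1_eq1)
  show "cayley_dickson_admissible (ground_algebra :: ('k, 'k) inv_algebra)"
    by (rule ground_algebra_admissible)
  show "c x = 0" if "(\<Sum>y\<in>UNIV. scal ground_algebra (c y) 1) = 0" for c :: "num1 \<Rightarrow> 'k" and x
    using that by (simp add: ground_algebra_def) (metis num1)
  show "invol ground_algebra (1 :: 'k) = (if x = 0 then 1 else - 1)" for x :: num1
    using num1[of x 0] by (simp add: ground_algebra_def)
  show "\<exists>c :: num1 \<Rightarrow> 'k. a = (\<Sum>y\<in>UNIV. scal ground_algebra (c y) 1)" for a :: 'k
    by (rule exI[of _ "\<lambda>_ :: num1. a"]) (simp add: ground_algebra_def)
qed (auto simp: ground_algebra_def unital_cochain_def)

text \<open>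
  In the doubled index group \<open>'h\<close>, which is identified with the product of \<open>'g\<close> and \<open>bit\<close> by the
  pair of maps \<open>\<pi>\<close> and \<open>\<tau>\<close>, the component \<open>\<tau> x\<close> tells whether the basis vector lies in the second
  summand \<open>v A\<close>. Keeping the two maps abstract allows \<open>bit ^ 3\<close>, say, to be used for the doubling
  of \<open>bit ^ 2\<close>. In the formula, the exchange of the arguments of \<open>F\<close> comes from
  \<open>v b \<cdot> c = v (c b)\<close> and \<open>v b \<cdot> v d = \<alpha> d \<sigma>(b)\<close>, and the middle sign from the involution that is
  applied to the left factor exactly when the right factor lies in \<open>v A\<close>.
\<close>

definition doubled_cochain ::
  "'k::field \<Rightarrow> ('h \<Rightarrow> 'g::ab_group_add) \<Rightarrow> ('h \<Rightarrow> bit) \<Rightarrow> ('g \<Rightarrow> 'g \<Rightarrow> 'k) \<Rightarrow> 'h \<Rightarrow> 'h \<Rightarrow> 'k" where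
  "doubled_cochain \<alpha> \<pi> \<tau> F x y =
     (if \<tau> x = 0 then F (\<pi> x) (\<pi> y) else F (\<pi> y) (\<pi> x)) *
     (if \<tau> y = 1 \<and> \<pi> x \<noteq> 0 then - 1 else 1) *
     (if \<tau> x = 1 \<and> \<tau> y = 1 then \<alpha> else 1)"

definition doubled_basis ::
  "('h \<Rightarrow> 'g) \<Rightarrow> ('h \<Rightarrow> bit) \<Rightarrow> ('g \<Rightarrow> 'a::zero) \<Rightarrow> 'h \<Rightarrow> 'a \<times> 'a" where
  "doubled_basis \<pi> \<tau> e x = (if \<tau> x = 0 then (e (\<pi> x), 0) else (0, e (\<pi> x)))"

text \<open>
  The involution is an assumption of the locale because it enters the doubled product; that it acts
  on basis vectors by signs keeps the products of basis vectors proportional to basis vectors. When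
  the left factor is in \<open>v A\<close> the factors are multiplied in \<open>A\<close> in the opposite order, so the
  index of the product is correct only because the group is commutative. The values of the new
  cochain are nonzero because \<open>\<alpha> \<noteq> 0\<close>.
\<close>

theorem (in twisted_basis) twisted_basis_cayley_dickson:
  fixes \<pi> :: "'h::{finite, ab_group_add} \<Rightarrow> 'g" and \<tau> :: "'h \<Rightarrow> bit"
  assumes bij: "bij (\<lambda>x. (\<pi> x, \<tau> x))"
    and \<pi>_add: "\<And>x y. \<pi> (x + y) = \<pi> x + \<pi> y"
    and \<tau>_add: "\<And>x y. \<tau> (x + y) = \<tau> x + \<tau> y"
    and \<alpha>: "\<alpha> \<noteq> 0"
  shows "twisted_basis (cayley_dickson \<alpha> A) (doubled_cochain \<alpha> \<pi> \<tau> F) (doubled_basis \<pi> \<tau> e)"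
proof
  let ?C = "cayley_dickson \<alpha> A" and ?e = "doubled_basis \<pi> \<tau> e"
  have \<pi>0: "\<pi> 0 = 0" and \<tau>0: "\<tau> 0 = 0"
    using \<pi>_add[of 0 0] \<tau>_add[of 0 0] by (simp_all del: add_bit_eq_xor)
  have invol0: "invol A 0 = 0"
    using admissible unfolding cayley_dickson_admissible_def
    by (meson Vector_Spaces.linear.axioms(3) module_hom.zero)
  define \<iota> where "\<iota> g b = inv (\<lambda>x. (\<pi> x, \<tau> x)) (g, b)" for g b
  have \<pi>\<iota>: "\<pi> (\<iota> g b) = g" and \<tau>\<iota>: "\<tau> (\<iota> g b) = b" for g b
    using surj_f_inv_f[OF bij_is_surj[OF bij], of "(g, b)"] by (auto simp: \<iota>_def)
  have \<iota>: "\<iota> (\<pi> x) (\<tau> x) = x" for x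
    using inv_f_f[OF bij_is_inj[OF bij], of x] by (simp add: \<iota>_def)
  have bij\<iota>: "bij (\<lambda>(g, b). \<iota> g b)"
    using bij_imp_bij_inv[OF bij] by (simp add: \<iota>_def)
  \<comment> \<open>A combination in the doubled algebra is a pair of combinations in the original one, so that
    independence and spanning hold componentwise.\<close>
  have combo: "(\<Sum>x\<in>UNIV. scal ?C (c x) (?e x)) =
      (\<Sum>g\<in>UNIV. scal A (c (\<iota> g 0)) (e g), \<Sum>g\<in>UNIV. scal A (c (\<iota> g 1)) (e g))" for c
  proof -
    have "(\<Sum>x\<in>UNIV. scal ?C (c x) (?e x)) =
        (\<Sum>(g, b)\<in>UNIV \<times> UNIV. scal ?C (c (\<iota> g b)) (?e (\<iota> g b)))"
      using sum.reindex_bij_betw[OF bij\<iota>, of "\<lambda>x. scal ?C (c x) (?e x)"]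
      by (simp add: case_prod_unfold)
    also have "\<dots> = (\<Sum>g\<in>UNIV. \<Sum>b\<in>UNIV. scal ?C (c (\<iota> g b)) (?e (\<iota> g b)))"
      by (simp only: sum.cartesian_product)
    also have "\<dots> = (\<Sum>g\<in>UNIV. (scal A (c (\<iota> g 0)) (e g), scal A (c (\<iota> g 1)) (e g)))"
      by (rule sum.cong)
        (auto simp: UNIV_bit doubled_basis_def \<pi>\<iota> \<tau>\<iota> cayley_dickson_def)
    also have "\<dots> =
        (\<Sum>g\<in>UNIV. scal A (c (\<iota> g 0)) (e g), \<Sum>g\<in>UNIV. scal A (c (\<iota> g 1)) (e g))"
      by (simp add: prod_eq_iff fst_sum snd_sum)
    finally show ?thesis .
  qed
  show "cayley_dickson_admissible ?C"
    using admissible by (rule cayley_dickson_admissible_cayley_dickson)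
  show "unital_cochain (doubled_cochain \<alpha> \<pi> \<tau> F)"
    using cochain \<alpha> by (auto simp: unital_cochain_def doubled_cochain_def \<pi>0 \<tau>0)
  show "c x = 0" if "(\<Sum>x\<in>UNIV. scal ?C (c x) (?e x)) = 0" for c x
  proof -
    have "c (\<iota> g b) = 0" for g b
      using that independent[of "\<lambda>g. c (\<iota> g 0)" g] independent[of "\<lambda>g. c (\<iota> g 1)" g]
      unfolding combo by (cases b) (auto simp: zero_prod_def)
    then show ?thesis by (metis \<iota>)
  qed
  show "\<exists>c. a = (\<Sum>x\<in>UNIV. scal ?C (c x) (?e x))" for a
  proof -
    obtain c d where "fst a = (\<Sum>g\<in>UNIV. scal A (c g) (e g))"
      and "snd a = (\<Sum>g\<in>UNIV. scal A (d g) (e g))"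
      using spanning by metis
    then have "a = (\<Sum>x\<in>UNIV. scal ?C (if \<tau> x = 0 then c (\<pi> x) else d (\<pi> x)) (?e x))"
      unfolding combo by (simp add: \<pi>\<iota> \<tau>\<iota> prod_eq_iff)
    then show ?thesis by (rule exI[of _ "\<lambda>x. if \<tau> x = 0 then c (\<pi> x) else d (\<pi> x)"])
  qed
  show "mul ?C (?e x) (?e y) = scal ?C (doubled_cochain \<alpha> \<pi> \<tau> F x y) (?e (x + y))" for x y
    by (cases "\<tau> x"; cases "\<tau> y")
      (auto simp: cayley_dickson_def doubled_basis_def doubled_cochain_def \<pi>_add \<tau>_add
        mul_basis invol_basis invol0 L.zero R.zero L.neg R.neg add.commute mult.commute)
  show "invol ?C (?e x) = (if x = 0 then ?e x else - ?e x)" for x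
  proof -
    have "x = 0 \<longleftrightarrow> \<pi> x = 0 \<and> \<tau> x = 0"
      by (metis \<iota> \<pi>0 \<tau>0)
    then show ?thesis
      by (auto simp: cayley_dickson_def doubled_basis_def invol_basis invol0)
  qed
  show "unit ?C = ?e 0"
    by (simp add: cayley_dickson_def doubled_basis_def \<pi>0 \<tau>0 unit_basis)
qed

text \<open>
  Over \<open>bit\<close>, the case distinctions of \<open>doubled_cochain\<close> become polynomials: \<open>\<tau> x\<close> times the
  antisymmetric part of \<open>f\<close> replaces \<open>f (\<pi> x) (\<pi> y)\<close> by \<open>f (\<pi> y) (\<pi> x)\<close> when \<open>\<tau> x = 1\<close>, the
  next term is the sign of \<open>e (\<pi> x)\<close> under the involution, and the last one is the factor
  \<open>\<alpha> = -1\<close>.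
\<close>

definition doubled_exponent ::
  "('h \<Rightarrow> 'g::ab_group_add) \<Rightarrow> ('h \<Rightarrow> bit) \<Rightarrow> ('g \<Rightarrow> 'g \<Rightarrow> bit) \<Rightarrow> 'h \<Rightarrow> 'h \<Rightarrow> bit" where
  "doubled_exponent \<pi> \<tau> f x y =
     f (\<pi> x) (\<pi> y) + \<tau> x * (f (\<pi> x) (\<pi> y) + f (\<pi> y) (\<pi> x)) +
     of_bool (\<pi> x \<noteq> 0) * \<tau> y + \<tau> x * \<tau> y"

lemma doubled_cochain_sign_cochain:
  "doubled_cochain (- 1) \<pi> \<tau> (sign_cochain f) = sign_cochain (doubled_exponent \<pi> \<tau> f)"
proof (intro ext)
  fix x y
  show "doubled_cochain (- 1) \<pi> \<tau> (sign_cochain f) x y = sign_cochain (doubled_exponent \<pi> \<tau> f) x y"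
    by (cases "\<tau> x"; cases "\<tau> y"; cases "f (\<pi> x) (\<pi> y)"; cases "f (\<pi> y) (\<pi> x)")
      (simp_all add: doubled_cochain_def doubled_exponent_def sign_cochain_def)
qed

text \<open>
  The exponent \<open>f'\<close> is kept apart from \<open>doubled_exponent \<pi> \<tau> f\<close> so that a closed formula can be
  carried from one doubling to the next.
\<close>

lemma twisted_basis_cayley_dickson_sign:
  fixes \<pi> :: "'h::{finite, ab_group_add} \<Rightarrow> 'g::{finite, ab_group_add}"
  assumes "twisted_basis A (sign_cochain f) e"
    and "bij (\<lambda>x. (\<pi> x, \<tau> x))"
    and "\<And>x y. \<pi> (x + y) = \<pi> x + \<pi> y"
    and "\<And>x y. \<tau> (x + y) = \<tau> x + \<tau> y"
    and "\<And>x y. f' x y = doubled_exponent \<pi> \<tau> f x y"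
  shows "twisted_basis (cayley_dickson (- 1) A) (sign_cochain f') (doubled_basis \<pi> \<tau> e)"
proof -
  have "f' = doubled_exponent \<pi> \<tau> f"
    using assms(5) by blast
  then show ?thesis
    using twisted_basis.twisted_basis_cayley_dickson[OF assms(1-4), of "- 1"]
    by (simp add: doubled_cochain_sign_cochain)
qed

section \<open>The index groups and the sign exponents\<close>

text \<open>
  Arithmetic on \<open>bit\<close> simplifies by default to bit operations, which hides the commutative ring
  structure. Polynomial identities over \<open>bit\<close> are proved here with those two rules removed, by
  multiplying out and cancelling equal summands.
\<close>

lemma bit_add_self: "a + a = (0::bit)" "a + (a + b) = (b::bit)"
  by (cases a; cases b; simp)+

lemmas bit_ring = algebra_simps bit_add_self

definition drop_coord2 :: "bit ^ 2 \<Rightarrow> bit" where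
  "drop_coord2 x = coord x 1"

definition drop_coord3 :: "bit ^ 3 \<Rightarrow> bit ^ 2" where
  "drop_coord3 x = vector [coord x 1, coord x 2]"

definition drop_coord4 :: "bit ^ 4 \<Rightarrow> bit ^ 3" where
  "drop_coord4 x = vector [coord x 1, coord x 2, coord x 3]"

lemma bij_drop:
  shows "bij (\<lambda>x. (drop_coord2 x, coord x 2))"
    and "bij (\<lambda>x. (drop_coord3 x, coord x 3))"
    and "bij (\<lambda>x. (drop_coord4 x, coord x 4))"
proof -
  show "bij (\<lambda>x. (drop_coord2 x, coord x 2))"
    by (rule bij_betw_byWitness[of _ "\<lambda>(y, b). vector [y, b]"])
      (auto simp: drop_coord2_def coord_def vec_eq_iff forall_2)
  show "bij (\<lambda>x. (drop_coord3 x, coord x 3))"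
    by (rule bij_betw_byWitness[of _ "\<lambda>(y, b). vector [coord y 1, coord y 2, b]"])
      (auto simp: drop_coord3_def coord_def vec_eq_iff forall_2 forall_3)
  show "bij (\<lambda>x. (drop_coord4 x, coord x 4))"
    by (rule bij_betw_byWitness[of _ "\<lambda>(y, b). \<chi> i. if i = 1 then coord y 1
        else if i = 2 then coord y 2 else if i = 3 then coord y 3 else b"])
      (auto simp: drop_coord4_def coord_def vec_eq_iff forall_3 forall_4)
qed

lemma coord_add: "coord (x + y) i = coord x i + coord y i"
  by (simp add: coord_def)

lemma drop_add:
  shows "drop_coord2 (x2 + y2) = drop_coord2 x2 + drop_coord2 y2"
    and "drop_coord3 (x3 + y3) = drop_coord3 x3 + drop_coord3 y3"
    and "drop_coord4 (x4 + y4) = drop_coord4 x4 + drop_coord4 y4"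
  by (simp_all add: drop_coord2_def drop_coord3_def drop_coord4_def coord_def vec_eq_iff forall_2 forall_3
      del: add_bit_eq_xor)

lemma coord_drop:
  shows "coord (drop_coord3 x3) 1 = coord x3 1"
    and "coord (drop_coord3 x3) 2 = coord x3 2"
    and "coord (drop_coord4 x4) 1 = coord x4 1"
    and "coord (drop_coord4 x4) 2 = coord x4 2"
    and "coord (drop_coord4 x4) 3 = coord x4 3"
  by (simp_all add: drop_coord3_def drop_coord4_def coord_def)

text \<open>
  These are the polynomials $1 + \prod_i (1 + x_i)$ multiplied out: the product is the indicator
  of $\vec x = 0$. Each of them becomes, in the exponent of the next algebra, the coefficient of the
  last coordinate of $\vec y$, up to the summand $x_n$ with \<open>n\<close> the number of that coordinate.
\<close>

lemma of_bool_nonzero: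
  fixes b :: bit and x :: "bit ^ 2" and y :: "bit ^ 3"
  shows "of_bool (b \<noteq> 0) = b"
    and "of_bool (x \<noteq> 0) = coord x 1 + coord x 2 + coord x 1 * coord x 2"
    and "of_bool (y \<noteq> 0) = coord y 1 + coord y 2 + coord y 3 + coord y 1 * coord y 2 +
      coord y 1 * coord y 3 + coord y 2 * coord y 3 + coord y 1 * coord y 2 * coord y 3"
proof -
  show "of_bool (b \<noteq> 0) = b"
    by (cases b) simp_all
  show "of_bool (x \<noteq> 0) = coord x 1 + coord x 2 + coord x 1 * coord x 2"
    by (cases "coord x 1"; cases "coord x 2"; simp add: coord_def vec_eq_iff forall_2)
  show "of_bool (y \<noteq> 0) = coord y 1 + coord y 2 + coord y 3 + coord y 1 * coord y 2 +
      coord y 1 * coord y 3 + coord y 2 * coord y 3 + coord y 1 * coord y 2 * coord y 3"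
    by (cases "coord y 1"; cases "coord y 2"; cases "coord y 3";
        simp add: coord_def vec_eq_iff forall_3)
qed

definition quaternion_exponent :: "bit ^ 2 \<Rightarrow> bit ^ 2 \<Rightarrow> bit" where
  "quaternion_exponent x y = coord x 1 * coord y 1 + (coord x 1 + coord x 2) * coord y 2"

definition octonion_exponent :: "bit ^ 3 \<Rightarrow> bit ^ 3 \<Rightarrow> bit" where
  "octonion_exponent x y =
     (\<Sum>i\<in>{1..3}. \<Sum>j\<in>{i..3}. coord x i * coord y j)
     + coord y 1 * coord x 2 * coord x 3
     + coord x 1 * coord y 2 * coord x 3
     + coord x 1 * coord x 2 * coord y 3"

definition sixteen_onion_exponent :: "bit ^ 4 \<Rightarrow> bit ^ 4 \<Rightarrow> bit" where
  "sixteen_onion_exponent x y =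
     (\<Sum>i\<in>{1..4}. \<Sum>j\<in>{i..4}. coord x i * coord y j)
     + (\<Sum>i\<in>{1..4}. \<Sum>j\<in>{i<..4}. \<Sum>k\<in>{1..4} - {i, j}.
          coord x i * coord x j * coord y k)
     + (\<Sum>l\<in>{1..4}. (\<Prod>i\<in>{1..4} - {l}. coord x i) * coord y l)
     + (\<Sum>(i, j, k)\<in>{(i, j, k). {i, j, k} = {1, 2, 3} \<and> j < k}.
          coord x i * coord y j * coord y k * coord x 4)"

lemma quaternion_exponent_doubled:
  "quaternion_exponent x y = doubled_exponent drop_coord2 (\<lambda>x. coord x 2) (*) x y"
  by (simp add: quaternion_exponent_def doubled_exponent_def drop_coord2_def of_bool_nonzero bit_ring
      del: add_bit_eq_xor mult_bit_eq_and One_nat_def)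

lemma octonion_exponent_expand:
  "octonion_exponent x y =
     coord x 1 * coord y 1 + coord x 1 * coord y 2 + coord x 1 * coord y 3
     + coord x 2 * coord y 2 + coord x 2 * coord y 3 + coord x 3 * coord y 3
     + coord y 1 * coord x 2 * coord x 3
     + coord x 1 * coord y 2 * coord x 3
     + coord x 1 * coord x 2 * coord y 3"
proof -
  have "{1..3} = {1, 2, 3::nat}" "{2..3} = {2, 3::nat}" by auto
  then show ?thesis
    by (simp add: octonion_exponent_def add.assoc del: add_bit_eq_xor mult_bit_eq_and One_nat_def)
qed

lemma octonion_exponent_doubled:
  "octonion_exponent x y =
     doubled_exponent drop_coord3 (\<lambda>x. coord x 3) quaternion_exponent x y"
  by (simp add: octonion_exponent_expand quaternion_exponent_def doubled_exponent_def coord_drop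
      of_bool_nonzero bit_ring del: add_bit_eq_xor mult_bit_eq_and One_nat_def)

lemma permutation_triples:
  "{(i, j, k). {i, j, k} = {1, 2, 3} \<and> j < k} = {(1, 2, 3), (2, 1, 3), (3, 1, 2::nat)}"
    (is "?S = _")
proof (intro set_eqI iffI)
  fix p assume "p \<in> ?S"
  then obtain i j k where p: "p = (i, j, k)" and S: "{i, j, k} = {1, 2, 3}" and "j < k"
    by blast
  have mem: "i \<in> {1, 2, 3}" "j \<in> {1, 2, 3}" "k \<in> {1, 2, 3}"
    unfolding S[symmetric] by simp_all
  have all: "1 \<in> {i, j, k}" "2 \<in> {i, j, k}" "3 \<in> {i, j, k}"
    unfolding S by simp_all
  show "p \<in> {(1, 2, 3), (2, 1, 3), (3, 1, 2)}"
    using mem by (elim insertE emptyE) (use all \<open>j < k\<close> in \<open>simp_all add: p\<close>)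
qed auto

text \<open>
  Multiplied by \<open>x\<^sub>4\<close>, the terms below become the part of the sixteen-onion exponent that involves
  \<open>x\<^sub>4\<close> but not \<open>y\<^sub>4\<close>. The last three, which are the cubic terms of the octonion exponent with
  $\vec x$ and $\vec y$ exchanged, give its terms $x_i y_j y_k x_4$.
\<close>

lemma octonion_exponent_antisymmetric_part:
  "octonion_exponent x y + octonion_exponent y x =
     coord x 1 * coord y 2 + coord x 2 * coord y 1 + coord x 1 * coord y 3
     + coord x 3 * coord y 1 + coord x 2 * coord y 3 + coord x 3 * coord y 2
     + coord y 1 * coord x 2 * coord x 3
     + coord x 1 * coord y 2 * coord x 3
     + coord x 1 * coord x 2 * coord y 3
     + coord x 1 * coord y 2 * coord y 3
     + coord x 2 * coord y 1 * coord y 3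
     + coord x 3 * coord y 1 * coord y 2"
  by (simp add: octonion_exponent_expand bit_ring
      del: add_bit_eq_xor mult_bit_eq_and One_nat_def)

lemma sixteen_onion_exponent_doubled:
  "sixteen_onion_exponent x y =
     doubled_exponent drop_coord4 (\<lambda>x. coord x 4) octonion_exponent x y"
proof -
  have I: "{1..4} = {1, 2, 3, 4::nat}" "{2..4} = {2, 3, 4::nat}" "{3..4} = {3, 4::nat}"
    "{1<..4} = {2, 3, 4::nat}" "{2<..4} = {3, 4::nat}" "{3<..4} = {4::nat}"
    by auto
  show ?thesis
    unfolding doubled_exponent_def octonion_exponent_antisymmetric_part
    by (simp add: sixteen_onion_exponent_def I permutation_triples octonion_exponent_expand
        coord_drop of_bool_nonzero insert_Diff_if algebra_simps
        del: add_bit_eq_xor mult_bit_eq_and One_nat_def)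
qed

section \<open>The four algebras\<close>

text \<open>
  The complex numbers are the doubling of the one-dimensional algebra with trivial index group;
  from there each algebra is the doubling of the previous one along the last coordinate.
\<close>

theorem proposition4p4:
  assumes "CHAR('k::field) \<noteq> 2"
  shows "of_form_kFG (complex_number_algebra :: ('k, _) inv_algebra)
           (sign_cochain (\<lambda>x y :: bit. x * y)) \<and>
         of_form_kFG (quaternion_algebra :: ('k, _) inv_algebra)
           (sign_cochain (\<lambda>x y :: bit ^ 2.
              coord x 1 * coord y 1 + (coord x 1 + coord x 2) * coord y 2)) \<and>
         of_form_kFG (octonion_algebra :: ('k, _) inv_algebra)
           (sign_cochain (\<lambda>x y :: bit ^ 3.
              (\<Sum>i\<in>{1..3}. \<Sum>j\<in>{i..3}. coord x i * coord y j)
              + coord y 1 * coord x 2 * coord x 3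
              + coord x 1 * coord y 2 * coord x 3
              + coord x 1 * coord x 2 * coord y 3)) \<and>
         of_form_kFG (sixteen_onion_algebra :: ('k, _) inv_algebra)
           (sign_cochain (\<lambda>x y :: bit ^ 4.
              (\<Sum>i\<in>{1..4}. \<Sum>j\<in>{i..4}. coord x i * coord y j)
              + (\<Sum>i\<in>{1..4}. \<Sum>j\<in>{i<..4}. \<Sum>k\<in>{1..4} - {i, j}.
                   coord x i * coord x j * coord y k)
              + (\<Sum>l\<in>{1..4}. (\<Prod>i\<in>{1..4} - {l}. coord x i) * coord y l)
              + (\<Sum>(i, j, k)\<in>{(i, j, k). {i, j, k} = {1, 2, 3} \<and> j < k}.
                   coord x i * coord y j * coord y k * coord x 4)))"
proof -
  have C: "twisted_basis (complex_number_algebra :: ('k, _) inv_algebra) (sign_cochain (*))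
      (doubled_basis (\<lambda>_. 0 :: num1) id (\<lambda>_. 1))"
    unfolding complex_number_algebra_def
  proof (rule twisted_basis_cayley_dickson_sign[where f = "\<lambda>_ _ :: num1. 0"])
    show "twisted_basis (ground_algebra :: ('k, 'k) inv_algebra)
        (sign_cochain (\<lambda>_ _ :: num1. 0)) (\<lambda>_. 1)"
      using twisted_basis_ground by (simp add: sign_cochain_def[abs_def])
    show "bij (\<lambda>x. (0 :: num1, id x))"
      by (auto simp: bij_def inj_on_def surj_def) (metis num1_eq1)
  qed (simp_all add: doubled_exponent_def)
  have H: "twisted_basis (quaternion_algebra :: ('k, _) inv_algebra)
      (sign_cochain quaternion_exponent)
      (doubled_basis drop_coord2 (\<lambda>x. coord x 2) (doubled_basis (\<lambda>_. 0 :: num1) id (\<lambda>_. 1)))"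
    unfolding quaternion_algebra_def
    by (rule twisted_basis_cayley_dickson_sign[OF C bij_drop(1) drop_add(1) coord_add
        quaternion_exponent_doubled])
  have O: "twisted_basis (octonion_algebra :: ('k, _) inv_algebra)
      (sign_cochain octonion_exponent)
      (doubled_basis drop_coord3 (\<lambda>x. coord x 3) (doubled_basis drop_coord2 (\<lambda>x. coord x 2)
        (doubled_basis (\<lambda>_. 0 :: num1) id (\<lambda>_. 1))))"
    unfolding octonion_algebra_def
    by (rule twisted_basis_cayley_dickson_sign[OF H bij_drop(2) drop_add(2) coord_add
        octonion_exponent_doubled])
  have S: "twisted_basis (sixteen_onion_algebra :: ('k, _) inv_algebra)
      (sign_cochain sixteen_onion_exponent)
      (doubled_basis drop_coord4 (\<lambda>x. coord x 4) (doubled_basis drop_coord3 (\<lambda>x. coord x 3)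
        (doubled_basis drop_coord2 (\<lambda>x. coord x 2) (doubled_basis (\<lambda>_. 0 :: num1) id (\<lambda>_. 1)))))"
    unfolding sixteen_onion_algebra_def
    by (rule twisted_basis_cayley_dickson_sign[OF O bij_drop(3) drop_add(3) coord_add
        sixteen_onion_exponent_doubled])
  show ?thesis
    using C H O S
    unfolding quaternion_exponent_def[abs_def] octonion_exponent_def[abs_def]
      sixteen_onion_exponent_def[abs_def]
    by (intro conjI; elim twisted_basis.of_form_kFG)
qed

end
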